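(* Let $X$ and $Y$ be coarse spaces and let $\eta\in\mathrm{CtrTotRel}(X,Y)$ be a controlled total relation. Then the following hold. (1) If $[\eta]$ is $(\mathcal B_c(X),\mathcal B_c(Y))$-proper, then for all $S_1,S_2\subset X$, $$\eta(S_1)\perp_{\mathrm{ad}}\eta(S_2)\text{ in }Y\ \Rightarrow\ S_1\perp_{\mathrm{ad}}S_2\text{ in }X.$$ (2) If $[\eta]$ is a monomorphism in $\mathbf{Coarse}_{\mathrm{CtrTotRel}}/\mathrm{close}$, then for all $S_1,S_2\subset X$, $$\eta(S_1)\perp_{\mathrm{ad}}\eta(S_2)\text{ in }Y\ \Leftrightarrow\ S_1\perp_{\mathrm{ad}}S_2\text{ in }X.$$
   Context: Throughout, "set" means an element of a fixed universe $\mathcal U$ with $\mathbb N\in\mathcal U$. Relations. For sets $X,Y$, a relation from $X$ to $Y$ is a subset $R\subset Y\times X$; $\mathrm{Rel}(X,Y)=\mathcal P(Y\times X)$, $\mathrm{Rel}(X)=\mathrm{Rel}(X,X)$. $S\circ R=\{(z,x)\mid \exists y,\ (z,y)\in S,\ (y,x)\in R\}$; $1_X^{\mathrm{Rel}}=\{(x,x)\mid x\in X\}$; $R^\dagger=\{(x,y)\mid (y,x)\in R\}$; $\mathrm{Ad}_R(E)=R\circ E\circ R^\dagger$ for $E\in\mathrm{Rel}(X)$; $R(S)=\{y\in Y\mid \exists s\in S,\ (y,s)\in R\}$ for $S\subset X$. $R$ is total if for every $x\in X$ there is $y\in Y$ with $(y,x)\in R$. Coarse spaces. A coarse structure on $X$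 is a subset $\mathcal E\subset\mathrm{Rel}(X)$ containing $1_X^{\mathrm{Rel}}$ and closed under composition, dagger, finite unions and passing to subsets; a coarse space is a pair $X=(X,\mathcal E_X)$. A relation $\eta\in\mathrm{Rel}(X,Y)$ between coarse spaces is controlled if $\mathrm{Ad}_\eta(E)\in\mathcal E_Y$ for all $E\in\mathcal E_X$; $\mathrm{CtrTotRel}(X,Y)$ is the set of controlled total relations. For relations, $\eta_1\prec\eta_2$ means $\eta_1\subset F\circ\eta_2\circ E$ for some $E\in\mathcal E_X,F\in\mathcal E_Y$; $\eta_1\sim\eta_2$ ("close") means $\eta_1\prec\eta_2$ and $\eta_2\prec\eta_1$. $\mathbf{Coarse}_{\mathrm{CtrTotRel}}/\mathrm{close}$ is the category whose objects are coarse spaces and whose morphisms $X\to Y$ are the $\sim$-classes $[\eta]$ of $\eta\in\mathrm{CtrTotRel}(X,Y)$, with $[\xi]\circ[\eta]=[\xi\circ\eta]$ and identities $[1_X^{\mathrm{Rel}}]$. Boundedness and properness. For a coarse space $X$, $\mathcal B(X)=\{E(B_0)\mid B_0\subset X\text{ finite},\ E\in\mathcal E_X\}$. The class $[\eta]$ is called $(\mathcal B_c(X),\mathcal B_c(Y))$-proper if $\eta^\dagger(B)\in\mathcal B(X)$ for every $B\in\mathcal B(Y)$; this is independent of the representative $\eta$ of $[\eta]$. Asymptotic disjointness. For $S_1,S_2\subset X$, $S_1\perp_{\mathrm{ad}}S_2$ in $X$ means that $E_1(S_1)\cap E_2(S_2)\in\mathcal B(X)$ for all $E_1,E_2\in\mathcal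 E_X$. *)

theory Defs
  imports Main
begin

section \<open>Relations\<close>

text \<open>
  A relation from \<open>X\<close> to \<open>Y\<close> is a subset of \<open>Y \<times> X\<close>: pairs are ordered (target, source).
  With this convention the composition \<open>S \<circ> R\<close> is literally \<^term>\<open>S O R\<close>, the dagger is
  \<^term>\<open>R\<inverse>\<close>, and the identity relation is \<^term>\<open>Id_on X\<close>. Only the image of a subset
  differs from the library image, which reads pairs in the opposite direction.
\<close>

definition Rel :: "'u set \<Rightarrow> 'u set \<Rightarrow> ('u \<times> 'u) set set" where
  "Rel X Y = Pow (Y \<times> X)"

definition rimage :: "('u \<times> 'u) set \<Rightarrow> 'u set \<Rightarrow> 'u set" where
  "rimage R S = {y. \<exists>s\<in>S. (y, s) \<in> R}"

definition Ad :: "('u \<times> 'u) set \<Rightarrow> ('u \<times> 'u) set \<Rightarrow> ('u \<times> 'u) set" where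
  "Ad R E = R O E O R\<inverse>"

definition total_rel :: "'u set \<Rightarrow> 'u set \<Rightarrow> ('u \<times> 'u) set \<Rightarrow> bool" where
  "total_rel X Y R \<longleftrightarrow> (\<forall>x\<in>X. \<exists>y\<in>Y. (y, x) \<in> R)"


section \<open>The universe\<close>

text \<open>
  The type \<open>'u\<close> plays the role of the universe as a class of elements, and
  \<open>\<U>\<close> consists of those subsets of it which are sets of the universe (small sets). The closure
  conditions are those of a Grothendieck universe containing the natural numbers, except that
  closure under power sets is weakened to closure under subsets. For a Grothendieck
  universe \<open>U\<close>, take \<open>'u = U\<close> and \<open>\<U> = U\<close>, every element of \<open>U\<close> being a subset of \<open>U\<close>. The
  weaker condition also admits models inside HOL, such as all subsets of an infinite type.
\<close>

definition universe :: "'u set set \<Rightarrow> bool" where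
  "universe \<U> \<longleftrightarrow>
     (\<exists>f :: nat \<Rightarrow> 'u. inj f \<and> range f \<in> \<U>) \<and>
     (\<forall>x y. {x, y} \<in> \<U>) \<and>
     (\<forall>A\<in>\<U>. \<forall>B. B \<subseteq> A \<longrightarrow> B \<in> \<U>) \<and>
     (\<forall>I\<in>\<U>. \<forall>A. (\<forall>i\<in>I. A i \<in> \<U>) \<longrightarrow> (\<Union>i\<in>I. A i) \<in> \<U>)"


section \<open>Coarse spaces\<close>

record 'u coarse =
  points :: "'u set"
  entourages :: "('u \<times> 'u) set set"

definition coarse_structure :: "'u set \<Rightarrow> ('u \<times> 'u) set set \<Rightarrow> bool" where
  "coarse_structure X \<E> \<longleftrightarrow>
     \<E> \<subseteq> Rel X X \<and>
     Id_on X \<in> \<E> \<and>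
     (\<forall>E\<in>\<E>. \<forall>F\<in>\<E>. E O F \<in> \<E>) \<and>
     (\<forall>E\<in>\<E>. E\<inverse> \<in> \<E>) \<and>
     (\<forall>\<F>. finite \<F> \<and> \<F> \<subseteq> \<E> \<longrightarrow> \<Union>\<F> \<in> \<E>) \<and>
     (\<forall>E\<in>\<E>. \<forall>F. F \<subseteq> E \<longrightarrow> F \<in> \<E>)"

definition coarse_space :: "'u set set \<Rightarrow> 'u coarse \<Rightarrow> bool" where
  "coarse_space \<U> X \<longleftrightarrow> points X \<in> \<U> \<and> coarse_structure (points X) (entourages X)"

definition controlled :: "'u coarse \<Rightarrow> 'u coarse \<Rightarrow> ('u \<times> 'u) set \<Rightarrow> bool" where
  "controlled X Y \<eta> \<longleftrightarrow> (\<forall>E\<in>entourages X. Ad \<eta> E \<in> entourages Y)"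

definition CtrTotRel :: "'u coarse \<Rightarrow> 'u coarse \<Rightarrow> ('u \<times> 'u) set set" where
  "CtrTotRel X Y =
     {\<eta> \<in> Rel (points X) (points Y). controlled X Y \<eta> \<and> total_rel (points X) (points Y) \<eta>}"

definition coarser :: "'u coarse \<Rightarrow> 'u coarse \<Rightarrow> ('u \<times> 'u) set \<Rightarrow> ('u \<times> 'u) set \<Rightarrow> bool" where
  "coarser X Y \<eta>1 \<eta>2 \<longleftrightarrow> (\<exists>E\<in>entourages X. \<exists>F\<in>entourages Y. \<eta>1 \<subseteq> F O \<eta>2 O E)"

definition close :: "'u coarse \<Rightarrow> 'u coarse \<Rightarrow> ('u \<times> 'u) set \<Rightarrow> ('u \<times> 'u) set \<Rightarrow> bool" where
  "close X Y \<eta>1 \<eta>2 \<longleftrightarrow> coarser X Y \<eta>1 \<eta>2 \<and> coarser X Y \<eta>2 \<eta>1"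


section \<open>The category of coarse spaces and closeness classes\<close>

definition close_rel :: "'u coarse \<Rightarrow> 'u coarse \<Rightarrow> (('u \<times> 'u) set \<times> ('u \<times> 'u) set) set" where
  "close_rel X Y = {(\<eta>1, \<eta>2). \<eta>1 \<in> CtrTotRel X Y \<and> \<eta>2 \<in> CtrTotRel X Y \<and> close X Y \<eta>1 \<eta>2}"

definition close_class :: "'u coarse \<Rightarrow> 'u coarse \<Rightarrow> ('u \<times> 'u) set \<Rightarrow> ('u \<times> 'u) set set" where
  "close_class X Y \<eta> = close_rel X Y `` {\<eta>}"

definition coarse_hom :: "'u coarse \<Rightarrow> 'u coarse \<Rightarrow> ('u \<times> 'u) set set set" where
  "coarse_hom X Y = CtrTotRel X Y // close_rel X Y"

text \<open>
  The composite \<open>\<Psi> \<circ> \<Phi> : X \<rightarrow> Z\<close>. The union over all representatives is a union of equal sets,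
  see \<open>coarse_comp_class\<close> below.
\<close>

definition coarse_comp ::
  "'u coarse \<Rightarrow> 'u coarse \<Rightarrow> ('u \<times> 'u) set set \<Rightarrow> ('u \<times> 'u) set set \<Rightarrow> ('u \<times> 'u) set set" where
  "coarse_comp X Z \<Psi> \<Phi> = (\<Union>\<xi>\<in>\<Psi>. \<Union>\<eta>\<in>\<Phi>. close_class X Z (\<xi> O \<eta>))"

definition coarse_mono ::
  "'u set set \<Rightarrow> 'u coarse \<Rightarrow> 'u coarse \<Rightarrow> ('u \<times> 'u) set set \<Rightarrow> bool" where
  "coarse_mono \<U> X Y \<Phi> \<longleftrightarrow>
     \<Phi> \<in> coarse_hom X Y \<and>
     (\<forall>Z. coarse_space \<U> Z \<longrightarrow>
        (\<forall>\<alpha>\<in>coarse_hom Z X. \<forall>\<beta>\<in>coarse_hom Z X.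
           coarse_comp Z Y \<Phi> \<alpha> = coarse_comp Z Y \<Phi> \<beta> \<longrightarrow> \<alpha> = \<beta>))"


section \<open>Boundedness, properness and asymptotic disjointness\<close>

definition bounded_sets :: "'u coarse \<Rightarrow> 'u set set" where
  "bounded_sets X = {rimage E B0 | E B0. B0 \<subseteq> points X \<and> finite B0 \<and> E \<in> entourages X}"

definition proper_rel :: "'u coarse \<Rightarrow> 'u coarse \<Rightarrow> ('u \<times> 'u) set \<Rightarrow> bool" where
  "proper_rel X Y \<eta> \<longleftrightarrow> (\<forall>B\<in>bounded_sets Y. rimage (\<eta>\<inverse>) B \<in> bounded_sets X)"

text \<open>
  Properness of a class does not depend on the representative, see \<open>proper_class_iff\<close> below.
\<close>

definition proper_class :: "'u coarse \<Rightarrow> 'u coarse \<Rightarrow> ('u \<times> 'u) set set \<Rightarrow> bool" where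
  "proper_class X Y \<Phi> \<longleftrightarrow> (\<exists>\<eta>\<in>\<Phi>. proper_rel X Y \<eta>)"

definition asymp_disjoint :: "'u coarse \<Rightarrow> 'u set \<Rightarrow> 'u set \<Rightarrow> bool" where
  "asymp_disjoint X S1 S2 \<longleftrightarrow>
     (\<forall>E1\<in>entourages X. \<forall>E2\<in>entourages X. rimage E1 S1 \<inter> rimage E2 S2 \<in> bounded_sets X)"


section \<open>Well-definedness\<close>

context
  fixes \<U> :: "'u set set" and X :: "'u coarse"
  assumes X: "coarse_space \<U> X"
begin

lemma ent_Rel: "E \<in> entourages X \<Longrightarrow> E \<subseteq> points X \<times> points X"
  using X unfolding coarse_space_def coarse_structure_def Rel_def by (meson PowD subsetD)

lemma ent_Id: "Id_on (points X) \<in> entourages X"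
  using X unfolding coarse_space_def coarse_structure_def by simp

lemma ent_comp: "E \<in> entourages X \<Longrightarrow> F \<in> entourages X \<Longrightarrow> E O F \<in> entourages X"
  using X unfolding coarse_space_def coarse_structure_def by simp

lemma ent_converse: "E \<in> entourages X \<Longrightarrow> E\<inverse> \<in> entourages X"
  using X unfolding coarse_space_def coarse_structure_def by simp

lemma ent_subset: "E \<in> entourages X \<Longrightarrow> F \<subseteq> E \<Longrightarrow> F \<in> entourages X"
  using X unfolding coarse_space_def coarse_structure_def by meson

lemma bounded_subset:
  assumes "B \<in> bounded_sets X" "C \<subseteq> B"
  shows "C \<in> bounded_sets X"
proof -
  obtain E B0 where E: "B = rimage E B0" "B0 \<subseteq> points X" "finite B0" "E \<in> entourages X"
    using assms(1) unfolding bounded_sets_def by blast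
  have "C = rimage (E \<inter> C \<times> UNIV) B0"
    using assms(2) E(1) unfolding rimage_def by auto
  moreover have "E \<inter> C \<times> UNIV \<in> entourages X"
    by (rule ent_subset[OF E(4)]) blast
  ultimately show ?thesis
    using E unfolding bounded_sets_def by blast
qed

lemma bounded_image:
  assumes "B \<in> bounded_sets X" "F \<in> entourages X"
  shows "rimage F B \<in> bounded_sets X"
proof -
  obtain E B0 where E: "B = rimage E B0" "B0 \<subseteq> points X" "finite B0" "E \<in> entourages X"
    using assms(1) unfolding bounded_sets_def by blast
  have "rimage F B = rimage (F O E) B0"
    unfolding E(1) rimage_def by blast
  with E ent_comp[OF assms(2) E(4)] show ?thesis
    unfolding bounded_sets_def by blast
qed

end

lemma coarser_refl:
  assumes "coarse_space \<U> X" "coarse_space \<U> Y" "\<eta> \<in> Rel (points X) (points Y)"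
  shows "coarser X Y \<eta> \<eta>"
proof -
  have "\<eta> \<subseteq> Id_on (points Y) O \<eta> O Id_on (points X)"
    using assms(3) unfolding Rel_def by blast
  then show ?thesis
    unfolding coarser_def using ent_Id[OF assms(1)] ent_Id[OF assms(2)] by blast
qed

lemma coarser_trans:
  assumes "coarse_space \<U> X" "coarse_space \<U> Y"
    and "coarser X Y \<eta>1 \<eta>2" "coarser X Y \<eta>2 \<eta>3"
  shows "coarser X Y \<eta>1 \<eta>3"
proof -
  obtain E F where 1: "E \<in> entourages X" "F \<in> entourages Y" "\<eta>1 \<subseteq> F O \<eta>2 O E"
    using assms(3) unfolding coarser_def by blast
  obtain E' F' where 2: "E' \<in> entourages X" "F' \<in> entourages Y" "\<eta>2 \<subseteq> F' O \<eta>3 O E'"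
    using assms(4) unfolding coarser_def by blast
  have "\<eta>1 \<subseteq> (F O F') O \<eta>3 O (E' O E)"
    using 1(3) 2(3) by blast
  then show ?thesis
    unfolding coarser_def
    by (intro bexI[OF _ ent_comp[OF assms(1) 2(1) 1(1)]] bexI[OF _ ent_comp[OF assms(2) 1(2) 2(2)]])
qed

lemma equiv_close_rel:
  assumes "coarse_space \<U> X" "coarse_space \<U> Y"
  shows "equiv (CtrTotRel X Y) (close_rel X Y)"
proof (rule equivI)
  show "close_rel X Y \<subseteq> CtrTotRel X Y \<times> CtrTotRel X Y"
    unfolding close_rel_def by blast
  show "refl_on (CtrTotRel X Y) (close_rel X Y)"
    using coarser_refl[OF assms]
    unfolding refl_on_def close_rel_def close_def CtrTotRel_def by blast
  show "sym (close_rel X Y)"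
    unfolding sym_def close_rel_def close_def by blast
  show "trans (close_rel X Y)"
    unfolding trans_def close_rel_def close_def using coarser_trans[OF assms] by blast
qed

lemma CtrTotRel_comp:
  assumes "\<eta> \<in> CtrTotRel X Y" "\<xi> \<in> CtrTotRel Y Z"
  shows "\<xi> O \<eta> \<in> CtrTotRel X Z"
proof -
  have "Ad (\<xi> O \<eta>) E = Ad \<xi> (Ad \<eta> E)" for E
    unfolding Ad_def by blast
  then have "controlled X Z (\<xi> O \<eta>)"
    using assms unfolding CtrTotRel_def controlled_def by auto
  moreover have "\<xi> O \<eta> \<in> Rel (points X) (points Z)"
    using assms unfolding CtrTotRel_def Rel_def by blast
  moreover have "total_rel (points X) (points Z) (\<xi> O \<eta>)"
    using assms unfolding CtrTotRel_def total_rel_def by blast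
  ultimately show ?thesis
    unfolding CtrTotRel_def by blast
qed

lemma CtrTotRel_Id:
  assumes "coarse_space \<U> X"
  shows "Id_on (points X) \<in> CtrTotRel X X"
proof -
  have "Ad (Id_on (points X)) E \<subseteq> E" for E
    unfolding Ad_def by blast
  then have "controlled X X (Id_on (points X))"
    unfolding controlled_def using ent_subset[OF assms] by blast
  then show ?thesis
    unfolding CtrTotRel_def Rel_def total_rel_def by blast
qed

lemma coarser_comp:
  assumes "coarse_space \<U> X" "coarse_space \<U> Y" "coarse_space \<U> Z"
    and "\<eta>' \<in> CtrTotRel X Y" "\<xi>' \<in> CtrTotRel Y Z"
    and "coarser X Y \<eta> \<eta>'" "coarser Y Z \<xi> \<xi>'"
  shows "coarser X Z (\<xi> O \<eta>) (\<xi>' O \<eta>')"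
proof -
  obtain E F where 1: "E \<in> entourages X" "F \<in> entourages Y" "\<eta> \<subseteq> F O \<eta>' O E"
    using assms(6) unfolding coarser_def by blast
  obtain E' F' where 2: "E' \<in> entourages Y" "F' \<in> entourages Z" "\<xi> \<subseteq> F' O \<xi>' O E'"
    using assms(7) unfolding coarser_def by blast
  define G where "G = E' O F"
  have G: "G \<in> entourages Y"
    unfolding G_def by (rule ent_comp[OF assms(2) 2(1) 1(2)])
  have "\<xi>' O G \<subseteq> Ad \<xi>' G O \<xi>'"
  proof
    fix p assume "p \<in> \<xi>' O G"
    then obtain z y y' where p: "p = (z, y')" "(z, y) \<in> \<xi>'" "(y, y') \<in> G"
      by blast
    then have "y' \<in> points Y"
      using ent_Rel[OF assms(2) G] by blast
    then obtain z' where "(z', y') \<in> \<xi>'"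
      using assms(5) unfolding CtrTotRel_def total_rel_def by blast
    with p show "p \<in> Ad \<xi>' G O \<xi>'"
      unfolding Ad_def by blast
  qed
  moreover have "\<xi> O \<eta> \<subseteq> F' O (\<xi>' O G) O \<eta>' O E"
    unfolding G_def using 1(3) 2(3) by blast
  ultimately have "\<xi> O \<eta> \<subseteq> (F' O Ad \<xi>' G) O (\<xi>' O \<eta>') O E"
    by blast
  moreover have "Ad \<xi>' G \<in> entourages Z"
    using assms(5) G unfolding CtrTotRel_def controlled_def by blast
  ultimately show ?thesis
    unfolding coarser_def by (intro bexI[OF _ 1(1)] bexI[OF _ ent_comp[OF assms(3) 2(2)]])
qed

lemma coarse_comp_class:
  assumes "coarse_space \<U> X" "coarse_space \<U> Y" "coarse_space \<U> Z"
    and "\<eta> \<in> CtrTotRel X Y" "\<xi> \<in> CtrTotRel Y Z"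
  shows "coarse_comp X Z (close_class Y Z \<xi>) (close_class X Y \<eta>) = close_class X Z (\<xi> O \<eta>)"
proof -
  have eq: "close_class X Z (\<xi>' O \<eta>') = close_class X Z (\<xi> O \<eta>)"
    if "\<xi>' \<in> close_class Y Z \<xi>" "\<eta>' \<in> close_class X Y \<eta>" for \<xi>' \<eta>'
  proof -
    have *: "\<xi>' \<in> CtrTotRel Y Z" "close Y Z \<xi> \<xi>'" "\<eta>' \<in> CtrTotRel X Y" "close X Y \<eta> \<eta>'"
      using that unfolding close_class_def close_rel_def by auto
    have "(\<xi>' O \<eta>', \<xi> O \<eta>) \<in> close_rel X Z"
      using CtrTotRel_comp[OF assms(4,5)] CtrTotRel_comp[OF *(3,1)]
        coarser_comp[OF assms(1-3)] assms(4,5) *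
      unfolding close_rel_def close_def by blast
    then show ?thesis
      unfolding close_class_def by (rule equiv_class_eq[OF equiv_close_rel[OF assms(1,3)]])
  qed
  have "\<xi> \<in> close_class Y Z \<xi>"
    unfolding close_class_def
    by (rule equiv_class_self[OF equiv_close_rel[OF assms(2,3)] assms(5)])
  moreover have "\<eta> \<in> close_class X Y \<eta>"
    unfolding close_class_def
    by (rule equiv_class_self[OF equiv_close_rel[OF assms(1,2)] assms(4)])
  ultimately show ?thesis
    unfolding coarse_comp_def using eq by blast
qed

lemma proper_rel_close:
  assumes "coarse_space \<U> X" "coarse_space \<U> Y"
    and "coarser X Y \<eta>' \<eta>" "proper_rel X Y \<eta>"
  shows "proper_rel X Y \<eta>'"
  unfolding proper_rel_def
proof
  fix B assume B: "B \<in> bounded_sets Y"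
  obtain E F where 1: "E \<in> entourages X" "F \<in> entourages Y" "\<eta>' \<subseteq> F O \<eta> O E"
    using assms(3) unfolding coarser_def by blast
  have "rimage (F\<inverse>) B \<in> bounded_sets Y"
    by (rule bounded_image[OF assms(2) B ent_converse[OF assms(2) 1(2)]])
  then have "rimage (\<eta>\<inverse>) (rimage (F\<inverse>) B) \<in> bounded_sets X"
    using assms(4) unfolding proper_rel_def by blast
  then have "rimage (E\<inverse>) (rimage (\<eta>\<inverse>) (rimage (F\<inverse>) B)) \<in> bounded_sets X"
    by (rule bounded_image[OF assms(1) _ ent_converse[OF assms(1) 1(1)]])
  moreover have "rimage (\<eta>'\<inverse>) B \<subseteq> rimage (E\<inverse>) (rimage (\<eta>\<inverse>) (rimage (F\<inverse>) B))"
  proof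
    fix x assume "x \<in> rimage (\<eta>'\<inverse>) B"
    then obtain b where "b \<in> B" "(b, x) \<in> F O \<eta> O E"
      using 1(3) unfolding rimage_def by blast
    then show "x \<in> rimage (E\<inverse>) (rimage (\<eta>\<inverse>) (rimage (F\<inverse>) B))"
      unfolding rimage_def by blast
  qed
  ultimately show "rimage (\<eta>'\<inverse>) B \<in> bounded_sets X"
    by (rule bounded_subset[OF assms(1)])
qed

lemma proper_class_iff:
  assumes "coarse_space \<U> X" "coarse_space \<U> Y" "\<eta> \<in> CtrTotRel X Y"
  shows "proper_class X Y (close_class X Y \<eta>) \<longleftrightarrow> proper_rel X Y \<eta>"
proof
  assume "proper_class X Y (close_class X Y \<eta>)"
  then obtain \<eta>' where "close X Y \<eta> \<eta>'" "proper_rel X Y \<eta>'"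
    unfolding proper_class_def close_class_def close_rel_def by blast
  then show "proper_rel X Y \<eta>"
    using proper_rel_close[OF assms(1,2)] unfolding close_def by blast
next
  assume "proper_rel X Y \<eta>"
  moreover have "\<eta> \<in> close_class X Y \<eta>"
    unfolding close_class_def
    by (rule equiv_class_self[OF equiv_close_rel[OF assms(1,2)] assms(3)])
  ultimately show "proper_class X Y (close_class X Y \<eta>)"
    unfolding proper_class_def by blast
qed

lemma universe_UNIV:
  assumes "infinite (UNIV :: 'u set)"
  shows "universe (UNIV :: 'u set set)"
proof -
  obtain f :: "nat \<Rightarrow> 'u" where "inj f"
    using infinite_countable_subset[OF assms] by blast
  then show ?thesis
    unfolding universe_def by (simp add: exI[of _ f])
qed

end

theory Submission
  imports Defs
begin

text \<open>
  The link between the two claims is that monomorphisms are exactly the coarse embeddings, of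
  which one direction is proved here: if \<open>[\<eta>]\<close> is a monomorphism then \<open>\<eta>\<inverse> O F O \<eta>\<close> is an entourage of
  \<open>X\<close> for every entourage \<open>F\<close> of \<open>Y\<close> (\<open>coarse_mono_reflects_entourages\<close>). For this, let
  \<open>D = \<eta>\<inverse> O F O \<eta>\<close>, a set of pairs of points of \<open>X\<close>, and regard \<open>D\<close> itself as a coarse space, with the
  largest structure making both coordinate projections to \<open>X\<close> controlled. The two projections
  become close after composition with \<open>\<eta>\<close>, because corresponding image points are \<open>F\<close>-close up
  to the controlled ambiguity of \<open>\<eta>\<close>. Cancelling \<open>[\<eta>]\<close> shows that the projections are themselves
  close, which says precisely that \<open>D\<close> is an entourage. The set \<open>D\<close> consists of pairs, so it has
  to be coded by points of the universe first (\<open>universe_pairing\<close>).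

  For a proper \<open>\<eta>\<close>, asymptotic disjointness is reflected since a point common to \<open>E\<^sub>1\<close>- and
  \<open>E\<^sub>2\<close>-thickenings of \<open>S\<^sub>1\<close> and \<open>S\<^sub>2\<close> is sent by \<open>\<eta>\<close> into the corresponding thickenings of \<open>\<eta>(S\<^sub>1)\<close> and
  \<open>\<eta>(S\<^sub>2)\<close>; hence it lies in the preimage of a bounded set. A coarse embedding is proper, so
  this covers one half of the equivalence. For the other half, a point common to thickenings
  of \<open>\<eta>(S\<^sub>1)\<close> and \<open>\<eta>(S\<^sub>2)\<close> produces points \<open>s\<^sub>1 \<in> S\<^sub>1\<close> and \<open>s\<^sub>2 \<in> S\<^sub>2\<close> related by a fixed entourage of \<open>X\<close>.
  So \<open>s\<^sub>2\<close> lies in a bounded set, and the given point lies in a thickening of its image.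
\<close>

section \<open>Bounded sets under controlled relations\<close>

lemma ent_Union:
  assumes "coarse_space \<U> X" "finite \<F>" "\<F> \<subseteq> entourages X"
  shows "\<Union>\<F> \<in> entourages X"
  using assms unfolding coarse_space_def coarse_structure_def by blast

lemma bounded_setsI:
  "E \<in> entourages X \<Longrightarrow> A \<subseteq> points X \<Longrightarrow> finite A \<Longrightarrow> rimage E A \<in> bounded_sets X"
  unfolding bounded_sets_def by blast

lemma CtrTotRel_Ad:
  "\<eta> \<in> CtrTotRel X Y \<Longrightarrow> E \<in> entourages X \<Longrightarrow> Ad \<eta> E \<in> entourages Y"
  unfolding CtrTotRel_def controlled_def by blast

lemma CtrTotRel_total:
  assumes "\<eta> \<in> CtrTotRel X Y" "x \<in> points X"
  obtains y where "y \<in> points Y" "(y, x) \<in> \<eta>"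
  using assms unfolding CtrTotRel_def total_rel_def by blast

text \<open>
  Totality moves the finite set of centres to \<open>Y\<close>, with one image point for each centre, and the
  radius \<open>E\<close> becomes \<open>Ad \<eta> E\<close>.
\<close>

lemma bounded_rimage_controlled:
  assumes \<eta>: "\<eta> \<in> CtrTotRel X Y" and "B \<in> bounded_sets X" and Y: "coarse_space \<U> Y"
  shows "rimage \<eta> B \<in> bounded_sets Y"
proof -
  obtain E B0 where E: "B = rimage E B0" "B0 \<subseteq> points X" "finite B0" "E \<in> entourages X"
    using assms(2) unfolding bounded_sets_def by blast
  have "\<forall>b\<in>B0. \<exists>y. y \<in> points Y \<and> (y, b) \<in> \<eta>"
    using E(2) CtrTotRel_total[OF \<eta>] by blast
  then obtain c where c: "\<forall>b\<in>B0. c b \<in> points Y \<and> (c b, b) \<in> \<eta>"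
    by metis
  have "rimage \<eta> B \<subseteq> rimage (Ad \<eta> E) (c ` B0)"
    using c unfolding E(1) rimage_def Ad_def by blast
  moreover have "rimage (Ad \<eta> E) (c ` B0) \<in> bounded_sets Y"
    by (intro bounded_setsI[OF CtrTotRel_Ad[OF \<eta> E(4)]]) (use c E(3) in auto)
  ultimately show ?thesis
    by (rule bounded_subset[OF Y, rotated])
qed


section \<open>Proper relations reflect asymptotic disjointness\<close>

lemma proper_reflects_asymp_disjoint:
  assumes X: "coarse_space \<U> X" and \<eta>: "\<eta> \<in> CtrTotRel X Y"
    and proper: "proper_rel X Y \<eta>"
    and disj: "asymp_disjoint Y (rimage \<eta> S1) (rimage \<eta> S2)"
  shows "asymp_disjoint X S1 S2"
  unfolding asymp_disjoint_def
proof (intro ballI)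
  fix E1 E2 assume E: "E1 \<in> entourages X" "E2 \<in> entourages X"
  let ?B = "rimage (Ad \<eta> E1) (rimage \<eta> S1) \<inter> rimage (Ad \<eta> E2) (rimage \<eta> S2)"
  have "?B \<in> bounded_sets Y"
    using disj CtrTotRel_Ad[OF \<eta>] E unfolding asymp_disjoint_def by blast
  then have "rimage (\<eta>\<inverse>) ?B \<in> bounded_sets X"
    using proper unfolding proper_rel_def by blast
  moreover have "rimage E1 S1 \<inter> rimage E2 S2 \<subseteq> rimage (\<eta>\<inverse>) ?B"
  proof
    fix x assume "x \<in> rimage E1 S1 \<inter> rimage E2 S2"
    then obtain s1 s2 where s: "s1 \<in> S1" "(x, s1) \<in> E1" "s2 \<in> S2" "(x, s2) \<in> E2"
      unfolding rimage_def by blast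
    then have "x \<in> points X" "s1 \<in> points X" "s2 \<in> points X"
      using ent_Rel[OF X] E by blast+
    then obtain y t1 t2 where "(y, x) \<in> \<eta>" "(t1, s1) \<in> \<eta>" "(t2, s2) \<in> \<eta>"
      using CtrTotRel_total[OF \<eta>] by metis
    with s show "x \<in> rimage (\<eta>\<inverse>) ?B"
      unfolding rimage_def Ad_def by blast
  qed
  ultimately show "rimage E1 S1 \<inter> rimage E2 S2 \<in> bounded_sets X"
    by (rule bounded_subset[OF X])
qed


section \<open>Coarse embeddings\<close>

definition reflects_entourages :: "'u coarse \<Rightarrow> 'u coarse \<Rightarrow> ('u \<times> 'u) set \<Rightarrow> bool" where
  "reflects_entourages X Y \<eta> \<longleftrightarrow> (\<forall>F\<in>entourages Y. \<eta>\<inverse> O F O \<eta> \<in> entourages X)"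

text \<open>
  The preimage of a ball of radius \<open>F\<close> about one point is either empty or contained in a ball of
  radius \<open>\<eta>\<inverse> O (F O F\<inverse>) O \<eta>\<close> about any of its own points. Only the centres with non-empty preimage
  contribute.
\<close>

lemma reflects_entourages_proper:
  assumes X: "coarse_space \<U> X" and Y: "coarse_space \<U> Y"
    and \<eta>: "\<eta> \<in> CtrTotRel X Y" and refl: "reflects_entourages X Y \<eta>"
  shows "proper_rel X Y \<eta>"
  unfolding proper_rel_def
proof
  fix B assume "B \<in> bounded_sets Y"
  then obtain F B0 where F: "B = rimage F B0" "B0 \<subseteq> points Y" "finite B0" "F \<in> entourages Y"
    unfolding bounded_sets_def by blast
  let ?P = "\<lambda>b. rimage (\<eta>\<inverse>) (rimage F {b})"
  let ?B1 = "{b \<in> B0. ?P b \<noteq> {}}"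
  let ?E = "\<eta>\<inverse> O (F O F\<inverse>) O \<eta>"
  have E: "?E \<in> entourages X"
    using refl ent_comp[OF Y F(4) ent_converse[OF Y F(4)]]
    unfolding reflects_entourages_def by blast
  \<comment> \<open>New centres: one point chosen in each non-empty preimage of a ball.\<close>
  have "(SOME x. x \<in> ?P b) \<in> ?P b" if "b \<in> ?B1" for b
    using that by (simp add: some_in_eq)
  then obtain c where c: "\<And>b. b \<in> ?B1 \<Longrightarrow> c b \<in> ?P b"
    by (rule that)
  have "?P b \<subseteq> points X" for b
    using \<eta> unfolding CtrTotRel_def Rel_def rimage_def by blast
  then have "c ` ?B1 \<subseteq> points X"
    using c by blast
  then have "rimage ?E (c ` ?B1) \<in> bounded_sets X"
    by (intro bounded_setsI[OF E]) (use F(3) in simp_all)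
  moreover have "rimage (\<eta>\<inverse>) B \<subseteq> rimage ?E (c ` ?B1)"
  proof
    fix x assume "x \<in> rimage (\<eta>\<inverse>) B"
    then obtain b y where b: "b \<in> B0" "(y, b) \<in> F" "(y, x) \<in> \<eta>"
      unfolding F(1) rimage_def by blast
    then have "b \<in> ?B1"
      unfolding rimage_def by blast
    moreover from c[OF this] obtain y' where "(y', b) \<in> F" "(y', c b) \<in> \<eta>"
      unfolding rimage_def by blast
    then have "(x, c b) \<in> ?E"
      using b by blast
    ultimately show "x \<in> rimage ?E (c ` ?B1)"
      unfolding rimage_def by blast
  qed
  ultimately show "rimage (\<eta>\<inverse>) B \<in> bounded_sets X"
    by (rule bounded_subset[OF X])
qed

text \<open>
  A point \<open>y\<close> near both images is near some \<open>t\<^sub>1 \<in> \<eta>(s\<^sub>1)\<close> and some \<open>t\<^sub>2 \<in> \<eta>(s\<^sub>2)\<close>, so \<open>(t\<^sub>2, t\<^sub>1)\<close>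
  lies in the entourage \<open>F2\<inverse> O F1\<close> and reflection makes \<open>s\<^sub>2\<close> near \<open>s\<^sub>1\<close> in \<open>X\<close>. Thus \<open>s\<^sub>2\<close> is confined to a bounded set.
\<close>

lemma reflects_entourages_preserves_asymp_disjoint:
  assumes X: "coarse_space \<U> X" and Y: "coarse_space \<U> Y"
    and \<eta>: "\<eta> \<in> CtrTotRel X Y" and refl: "reflects_entourages X Y \<eta>"
    and S2: "S2 \<subseteq> points X" and disj: "asymp_disjoint X S1 S2"
  shows "asymp_disjoint Y (rimage \<eta> S1) (rimage \<eta> S2)"
  unfolding asymp_disjoint_def
proof (intro ballI)
  fix F1 F2 assume F: "F1 \<in> entourages Y" "F2 \<in> entourages Y"
  let ?E = "\<eta>\<inverse> O (F2\<inverse> O F1) O \<eta>"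
  let ?B = "rimage ?E S1 \<inter> rimage (Id_on (points X)) S2"
  have "?E \<in> entourages X"
    using refl ent_comp[OF Y ent_converse[OF Y F(2)] F(1)]
    unfolding reflects_entourages_def by blast
  then have "?B \<in> bounded_sets X"
    using disj ent_Id[OF X] unfolding asymp_disjoint_def by blast
  then have "rimage F2 (rimage \<eta> ?B) \<in> bounded_sets Y"
    using bounded_image[OF Y _ F(2)] bounded_rimage_controlled[OF \<eta> _ Y] by blast
  moreover have "rimage F1 (rimage \<eta> S1) \<inter> rimage F2 (rimage \<eta> S2) \<subseteq> rimage F2 (rimage \<eta> ?B)"
  proof
    fix y assume "y \<in> rimage F1 (rimage \<eta> S1) \<inter> rimage F2 (rimage \<eta> S2)"
    then obtain s1 s2 t1 t2 where s: "s1 \<in> S1" "(t1, s1) \<in> \<eta>" "(y, t1) \<in> F1"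
        "s2 \<in> S2" "(t2, s2) \<in> \<eta>" "(y, t2) \<in> F2"
      unfolding rimage_def by blast
    then have "(s2, s1) \<in> ?E"
      by blast
    then have "s2 \<in> ?B"
      using s S2 unfolding rimage_def by blast
    then show "y \<in> rimage F2 (rimage \<eta> ?B)"
      using s(5,6) unfolding rimage_def by blast
  qed
  ultimately show "rimage F1 (rimage \<eta> S1) \<inter> rimage F2 (rimage \<eta> S2) \<in> bounded_sets Y"
    by (rule bounded_subset[OF Y])
qed


section \<open>Initial coarse structures\<close>

text \<open>
  The image \<open>map_prod p p ` E\<close> is \<open>Ad p E\<close> for the graph of \<open>p\<close>; so this is the largest coarse
  structure on \<open>Z\<close> for which every \<open>p\<close> in \<open>P\<close> is controlled as a map to \<open>X\<close>.
\<close>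

definition initial_coarse :: "'u set \<Rightarrow> ('u \<Rightarrow> 'u) set \<Rightarrow> 'u coarse \<Rightarrow> 'u coarse" where
  "initial_coarse Z P X =
     \<lparr>points = Z,
      entourages = {E. E \<subseteq> Z \<times> Z \<and> (\<forall>p\<in>P. map_prod p p ` E \<in> entourages X)}\<rparr>"

definition graph_on :: "'u set \<Rightarrow> ('u \<Rightarrow> 'u) \<Rightarrow> ('u \<times> 'u) set" where
  "graph_on Z p = (\<lambda>z. (p z, z)) ` Z"

lemma initial_coarse_points [simp]: "points (initial_coarse Z P X) = Z"
  unfolding initial_coarse_def by simp

lemma initial_coarse_entourage_iff:
  "E \<in> entourages (initial_coarse Z P X) \<longleftrightarrow>
     E \<subseteq> Z \<times> Z \<and> (\<forall>p\<in>P. map_prod p p ` E \<in> entourages X)"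
  unfolding initial_coarse_def by simp

lemma coarse_space_initial:
  assumes X: "coarse_space \<U> X" and Z: "Z \<in> \<U>" and P: "\<And>p. p \<in> P \<Longrightarrow> p ` Z \<subseteq> points X"
  shows "coarse_space \<U> (initial_coarse Z P X)"
  unfolding coarse_space_def coarse_structure_def
proof (intro conjI ballI allI impI)
  let ?I = "initial_coarse Z P X"
  show "points ?I \<in> \<U>"
    using Z by simp
  show "entourages ?I \<subseteq> Rel (points ?I) (points ?I)"
    unfolding Rel_def by (auto simp: initial_coarse_entourage_iff)
  have "map_prod p p ` Id_on Z \<in> entourages X" if "p \<in> P" for p
    by (rule ent_subset[OF X ent_Id[OF X]]) (use P[OF that] in auto)
  then show "Id_on (points ?I) \<in> entourages ?I"
    by (auto simp: initial_coarse_entourage_iff)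
next
  fix E F assume EF: "E \<in> entourages (initial_coarse Z P X)" "F \<in> entourages (initial_coarse Z P X)"
  have "map_prod p p ` (E O F) \<in> entourages X" if "p \<in> P" for p
  proof (rule ent_subset[OF X])
    show "(map_prod p p ` E) O (map_prod p p ` F) \<in> entourages X"
      using EF that ent_comp[OF X] unfolding initial_coarse_entourage_iff by blast
    show "map_prod p p ` (E O F) \<subseteq> (map_prod p p ` E) O (map_prod p p ` F)"
      by force
  qed
  then show "E O F \<in> entourages (initial_coarse Z P X)"
    using EF unfolding initial_coarse_entourage_iff by blast
next
  fix E assume E: "E \<in> entourages (initial_coarse Z P X)"
  have "map_prod p p ` (E\<inverse>) = (map_prod p p ` E)\<inverse>" for p :: "'a \<Rightarrow> 'a"
    by force
  then show "E\<inverse> \<in> entourages (initial_coarse Z P X)"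
    using E ent_converse[OF X] unfolding initial_coarse_entourage_iff by auto
next
  fix \<F> assume F: "finite \<F> \<and> \<F> \<subseteq> entourages (initial_coarse Z P X)"
  have "map_prod p p ` \<Union>\<F> \<in> entourages X" if "p \<in> P" for p
  proof -
    have "(`) (map_prod p p) ` \<F> \<subseteq> entourages X"
      using F that by (auto simp: initial_coarse_entourage_iff)
    then show ?thesis
      unfolding image_Union by (intro ent_Union[OF X]) (use F in auto)
  qed
  moreover have "\<Union>\<F> \<subseteq> Z \<times> Z"
    using F unfolding subset_iff initial_coarse_entourage_iff by blast
  ultimately show "\<Union>\<F> \<in> entourages (initial_coarse Z P X)"
    unfolding initial_coarse_entourage_iff by blast
next
  fix E F assume "E \<in> entourages (initial_coarse Z P X)" "F \<subseteq> E"
  then show "F \<in> entourages (initial_coarse Z P X)"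
    unfolding initial_coarse_entourage_iff using ent_subset[OF X] image_mono
    by (metis subset_trans)
qed

lemma graph_on_CtrTotRel:
  assumes X: "coarse_space \<U> X" and p: "p \<in> P" "p ` Z \<subseteq> points X"
  shows "graph_on Z p \<in> CtrTotRel (initial_coarse Z P X) X"
proof -
  have Ad: "Ad (graph_on Z p) E \<subseteq> map_prod p p ` E" for E
    unfolding Ad_def graph_on_def by force
  have "controlled (initial_coarse Z P X) X (graph_on Z p)"
    unfolding controlled_def
  proof
    fix E assume "E \<in> entourages (initial_coarse Z P X)"
    then have "map_prod p p ` E \<in> entourages X"
      using p(1) unfolding initial_coarse_entourage_iff by blast
    then show "Ad (graph_on Z p) E \<in> entourages X"
      by (rule ent_subset[OF X _ Ad])
  qed
  then show ?thesis
    using p(2) unfolding CtrTotRel_def Rel_def total_rel_def graph_on_def by auto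
qed

text \<open>
  If \<open>p\<close> is close to \<open>q\<close>, then \<open>p z\<close> is near \<open>q z'\<close> for some \<open>z'\<close> near \<open>z\<close>. As \<open>q\<close> is controlled,
  \<open>q z'\<close> is near \<open>q z\<close>, so \<open>z'\<close> can be replaced by \<open>z\<close>.
\<close>

lemma coarser_graphs_entourage:
  assumes X: "coarse_space \<U> X" and q: "q \<in> P"
    and coarser: "coarser (initial_coarse Z P X) X (graph_on Z p) (graph_on Z q)"
  shows "(\<lambda>z. (p z, q z)) ` Z \<in> entourages X"
proof -
  obtain E F where E: "E \<in> entourages (initial_coarse Z P X)" and F: "F \<in> entourages X"
    and sub: "graph_on Z p \<subseteq> F O graph_on Z q O E"
    using coarser unfolding coarser_def by blast
  have "F O (map_prod q q ` E) \<in> entourages X"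
    using E q ent_comp[OF X F] unfolding initial_coarse_entourage_iff by blast
  moreover have "(\<lambda>z. (p z, q z)) ` Z \<subseteq> F O (map_prod q q ` E)"
  proof
    fix u assume "u \<in> (\<lambda>z. (p z, q z)) ` Z"
    then obtain z where z: "z \<in> Z" "u = (p z, q z)"
      by blast
    then have "(p z, z) \<in> F O graph_on Z q O E"
      using sub unfolding graph_on_def by blast
    then obtain z' where "(p z, q z') \<in> F" "(z', z) \<in> E"
      unfolding graph_on_def by blast
    then show "u \<in> F O (map_prod q q ` E)"
      unfolding z(2) by force
  qed
  ultimately show ?thesis
    by (rule ent_subset[OF X])
qed


section \<open>Monomorphisms are coarse embeddings\<close>

lemma coarse_mono_cancel:
  assumes X: "coarse_space \<U> X" and Y: "coarse_space \<U> Y" and Z: "coarse_space \<U> Z"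
    and \<eta>: "\<eta> \<in> CtrTotRel X Y" and mono: "coarse_mono \<U> X Y (close_class X Y \<eta>)"
    and \<alpha>: "\<alpha> \<in> CtrTotRel Z X" and \<beta>: "\<beta> \<in> CtrTotRel Z X"
    and close: "close Z Y (\<eta> O \<alpha>) (\<eta> O \<beta>)"
  shows "close Z X \<alpha> \<beta>"
proof -
  have "(\<eta> O \<alpha>, \<eta> O \<beta>) \<in> close_rel Z Y"
    using close CtrTotRel_comp[OF \<alpha> \<eta>] CtrTotRel_comp[OF \<beta> \<eta>] unfolding close_rel_def by blast
  then have "close_class Z Y (\<eta> O \<alpha>) = close_class Z Y (\<eta> O \<beta>)"
    unfolding close_class_def by (rule equiv_class_eq[OF equiv_close_rel[OF Z Y]])
  then have "coarse_comp Z Y (close_class X Y \<eta>) (close_class Z X \<alpha>) =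
      coarse_comp Z Y (close_class X Y \<eta>) (close_class Z X \<beta>)"
    by (simp add: coarse_comp_class[OF Z X Y _ \<eta>] \<alpha> \<beta>)
  moreover have "close_class Z X \<alpha> \<in> coarse_hom Z X" "close_class Z X \<beta> \<in> coarse_hom Z X"
    using \<alpha> \<beta> unfolding coarse_hom_def close_class_def by (auto intro: quotientI)
  ultimately have "close_class Z X \<alpha> = close_class Z X \<beta>"
    using mono Z unfolding coarse_mono_def by blast
  then have "(\<alpha>, \<beta>) \<in> close_rel Z X"
    unfolding close_class_def using eq_equiv_class[OF _ equiv_close_rel[OF Z X] \<beta>] by blast
  then show ?thesis
    unfolding close_rel_def by blast
qed

text \<open>
  If \<open>p z\<close> and \<open>q z\<close> have some \<open>F\<close>-related images under \<open>\<eta>\<close>, then every image of \<open>p z\<close> is related to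
  one of \<open>q z\<close>, because the images of one point form a set of controlled size: any two are
  related by \<open>Ad \<eta> (Id_on (points X))\<close>.
\<close>

lemma coarser_graphs_comp:
  assumes X: "coarse_space \<U> X" and Y: "coarse_space \<U> Y" and Z: "coarse_space \<U> Z"
    and \<eta>: "\<eta> \<in> CtrTotRel X Y" and F: "F \<in> entourages Y"
    and pq: "\<And>z. z \<in> points Z \<Longrightarrow> (p z, q z) \<in> \<eta>\<inverse> O F O \<eta>"
  shows "coarser Z Y (\<eta> O graph_on (points Z) p) (\<eta> O graph_on (points Z) q)"
proof -
  let ?G = "Ad \<eta> (Id_on (points X)) O F"
  have "?G \<in> entourages Y"
    by (rule ent_comp[OF Y CtrTotRel_Ad[OF \<eta> ent_Id[OF X]] F])
  moreover have "\<eta> O graph_on (points Z) p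
      \<subseteq> ?G O (\<eta> O graph_on (points Z) q) O Id_on (points Z)"
  proof
    fix u assume "u \<in> \<eta> O graph_on (points Z) p"
    then obtain y z where z: "u = (y, z)" "z \<in> points Z" "(y, p z) \<in> \<eta>"
      unfolding graph_on_def by blast
    then obtain y1 y2 where y: "(y1, p z) \<in> \<eta>" "(y1, y2) \<in> F" "(y2, q z) \<in> \<eta>"
      using pq by blast
    have "p z \<in> points X"
      using z(3) \<eta> unfolding CtrTotRel_def Rel_def by blast
    then have "(y, y1) \<in> Ad \<eta> (Id_on (points X))"
      using z(3) y(1) unfolding Ad_def by blast
    then show "u \<in> ?G O (\<eta> O graph_on (points Z) q) O Id_on (points Z)"
      using y z unfolding graph_on_def by blast
  qed
  ultimately show ?thesis
    unfolding coarser_def using ent_Id[OF Z] by blast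
qed

lemma universe_subset: "universe \<U> \<Longrightarrow> A \<in> \<U> \<Longrightarrow> B \<subseteq> A \<Longrightarrow> B \<in> \<U>"
  unfolding universe_def by metis

text \<open>
  An infinite set has the cardinality of its square and so can itself serve as the set of codes; a
  finite square is coded in the copy of the natural numbers.
\<close>

lemma universe_pairing:
  fixes \<U> :: "'u set set"
  assumes U: "universe \<U>" and X: "X \<in> \<U>"
  obtains g :: "'u \<times> 'u \<Rightarrow> 'u" where "inj_on g (X \<times> X)" "g ` (X \<times> X) \<in> \<U>"
proof -
  have "\<exists>g :: 'u \<times> 'u \<Rightarrow> 'u. inj_on g (X \<times> X) \<and> g ` (X \<times> X) \<in> \<U>"
  proof (cases "finite X")
    case True
    obtain f :: "nat \<Rightarrow> 'u" where f: "inj f" "range f \<in> \<U>"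
      using conjunct1[OF U[unfolded universe_def]] by blast
    obtain h :: "'u \<times> 'u \<Rightarrow> nat" where h: "inj_on h (X \<times> X)"
      using finite_imp_inj_to_nat_seg[of "X \<times> X"] True by blast
    have "inj_on (f \<circ> h) (X \<times> X)"
      using h f(1) by (meson comp_inj_on inj_on_subset subset_UNIV)
    moreover have "(f \<circ> h) ` (X \<times> X) \<in> \<U>"
      by (rule universe_subset[OF U f(2)]) auto
    ultimately show ?thesis
      by blast
  next
    case False
    obtain g where "bij_betw g (X \<times> X) X"
      using card_of_Times_same_infinite[OF False] card_of_ordIso by blast
    then show ?thesis
      using X unfolding bij_betw_def by auto
  qed
  then show thesis
    using that by blast
qed

lemma coarse_mono_reflects_entourages:
  assumes U: "universe \<U>" and X: "coarse_space \<U> X" and Y: "coarse_space \<U> Y"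
    and \<eta>: "\<eta> \<in> CtrTotRel X Y" and mono: "coarse_mono \<U> X Y (close_class X Y \<eta>)"
  shows "reflects_entourages X Y \<eta>"
  unfolding reflects_entourages_def
proof
  fix F assume F: "F \<in> entourages Y"
  let ?D = "\<eta>\<inverse> O F O \<eta>"
  have D: "?D \<subseteq> points X \<times> points X"
    using \<eta> unfolding CtrTotRel_def Rel_def by blast
  obtain g where g: "inj_on g (points X \<times> points X)" "g ` (points X \<times> points X) \<in> \<U>"
    using universe_pairing[OF U] X unfolding coarse_space_def by blast
  have inj: "inj_on g ?D"
    by (rule inj_on_subset[OF g(1) D])
  define Z where "Z = g ` ?D"
  \<comment> \<open>The coordinate projections of \<open>?D\<close>, read off the codes in \<open>Z\<close>.\<close>
  define p where "p = fst \<circ> inv_into ?D g"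
  define q where "q = snd \<circ> inv_into ?D g"
  have pq: "(p z, q z) = inv_into ?D g z" for z
    unfolding p_def q_def by simp
  have pq_D: "(\<lambda>z. (p z, q z)) ` Z = ?D"
    unfolding pq Z_def image_image using inv_into_f_f[OF inj] by simp
  have "Z \<in> \<U>"
    unfolding Z_def by (rule universe_subset[OF U g(2) image_mono[OF D]])
  moreover have pX: "p ` Z \<subseteq> points X" and qX: "q ` Z \<subseteq> points X"
    using pq_D D by blast+
  ultimately have I: "coarse_space \<U> (initial_coarse Z {p, q} X)"
    by (intro coarse_space_initial[OF X]) auto
  have p: "graph_on Z p \<in> CtrTotRel (initial_coarse Z {p, q} X) X"
    by (rule graph_on_CtrTotRel[OF X _ pX]) simp
  have q: "graph_on Z q \<in> CtrTotRel (initial_coarse Z {p, q} X) X"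
    by (rule graph_on_CtrTotRel[OF X _ qX]) simp
  have in_D: "(p z, q z) \<in> ?D" if "z \<in> Z" for z
    using pq_D that by blast
  then have in_D': "(q z, p z) \<in> \<eta>\<inverse> O F\<inverse> O \<eta>" if "z \<in> Z" for z
    using that by blast
  have "close (initial_coarse Z {p, q} X) Y (\<eta> O graph_on Z p) (\<eta> O graph_on Z q)"
    unfolding close_def
    using coarser_graphs_comp[OF X Y I \<eta> F, of p q] in_D
      coarser_graphs_comp[OF X Y I \<eta> ent_converse[OF Y F], of q p] in_D'
    by simp
  then have "close (initial_coarse Z {p, q} X) X (graph_on Z p) (graph_on Z q)"
    by (rule coarse_mono_cancel[OF X Y I \<eta> mono p q])
  then have "(\<lambda>z. (p z, q z)) ` Z \<in> entourages X"
    unfolding close_def by (intro coarser_graphs_entourage[OF X, of q "{p, q}"]) auto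
  then show "?D \<in> entourages X"
    unfolding pq_D .
qed


section \<open>Asymptotic disjointness of images\<close>

theorem theorem7p17:
  fixes \<U> :: "'u set set" and X Y :: "'u coarse" and \<eta> :: "('u \<times> 'u) set"
  assumes "universe \<U>"
    and "coarse_space \<U> X" and "coarse_space \<U> Y"
    and "\<eta> \<in> CtrTotRel X Y"
  shows "(proper_class X Y (close_class X Y \<eta>) \<longrightarrow>
            (\<forall>S1 S2. S1 \<subseteq> points X \<longrightarrow> S2 \<subseteq> points X \<longrightarrow>
               asymp_disjoint Y (rimage \<eta> S1) (rimage \<eta> S2) \<longrightarrow> asymp_disjoint X S1 S2)) \<and>
         (coarse_mono \<U> X Y (close_class X Y \<eta>) \<longrightarrow>
            (\<forall>S1 S2. S1 \<subseteq> points X \<longrightarrow> S2 \<subseteq> points X \<longrightarrow>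
               (asymp_disjoint Y (rimage \<eta> S1) (rimage \<eta> S2) \<longleftrightarrow> asymp_disjoint X S1 S2)))"
proof (intro conjI impI allI)
  fix S1 S2
  assume "proper_class X Y (close_class X Y \<eta>)"
    and "asymp_disjoint Y (rimage \<eta> S1) (rimage \<eta> S2)"
  then show "asymp_disjoint X S1 S2"
    using proper_reflects_asymp_disjoint assms(2,4) proper_class_iff[OF assms(2-4)] by blast
next
  fix S1 S2
  assume "coarse_mono \<U> X Y (close_class X Y \<eta>)" and S2: "S2 \<subseteq> points X"
  then have refl: "reflects_entourages X Y \<eta>"
    by (intro coarse_mono_reflects_entourages[OF assms])
  show "asymp_disjoint Y (rimage \<eta> S1) (rimage \<eta> S2) \<longleftrightarrow> asymp_disjoint X S1 S2"
    using proper_reflects_asymp_disjoint[OF assms(2,4)]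
      reflects_entourages_proper[OF assms(2-4) refl]
      reflects_entourages_preserves_asymp_disjoint[OF assms(2-4) refl S2]
    by blast
qed

end
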